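(* Let $(c_k)_{k\in\mathbb{Z}}\subset\mathbb{R}$ be a bounded positive sequence. Let $\alpha\in(0,1)\setminus\mathbb{Q}$ and define the sequence $(a_k)_{k\in\mathbb{Z}}$ by $a_{2k}=k$, $a_{2k+1}=k+\alpha$ for $k\in\mathbb{Z}$. Let $\chi=\mathbf{1}_{(0,1)}$ and $$\varphi=\sum_{k\in\mathbb{Z}} c_k\mathbf{1}_{(a_k,a_{k+1})}.$$ (i) If $(c_k)_{k\in\mathbb{Z}}$ is monotonic, then $\varphi\in L^\infty(\mathbb{R})$ and $V_\chi\varphi$ never vanishes, i.e. $V_\chi\varphi(x,\xi)\neq 0$ for all $(x,\xi)\in\mathbb{R}^2$. (ii) If $\varphi\in L^p(\mathbb{R})$ for some $1\le p<\infty$, then there exists $(x,\xi)\in\mathbb{R}^2$ such that $V_\chi\varphi(x,\xi)=0$.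
   Context: For the window $\chi=\mathbf{1}_{(0,1)}$ and a bounded measurable function $\varphi$ on $\mathbb{R}$, the short-time Fourier transform is $$V_\chi\varphi(x,\xi)=\int_{\mathbb{R}}\varphi(t)\,\overline{\chi(t-x)}\,e^{-2\pi i\xi t}\,dt,\qquad (x,\xi)\in\mathbb{R}^2.$$ $\mathbf{1}_E$ denotes the indicator function of the set $E$.
   Formalization: In (i), "monotonic" is taken to mean strictly monotonic; if c_k = c_{k+1} for some k (e.g. a constant sequence), then V_χφ(a_k, 1) = 0, so (i) fails for every sequence that is monotonic but not strictly so. *)

theory Defs
  imports "HOL-Analysis.Analysis"
begin

text \<open>
  Membership in the Lebesgue spaces on the real line is a property of functions
  (representatives) that is invariant under equality almost everywhere.
\<close>

definition in_Lp :: "real \<Rightarrow> (real \<Rightarrow> complex) \<Rightarrow> bool" where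
  "in_Lp p f \<longleftrightarrow>
     f \<in> borel_measurable lebesgue \<and> integrable lebesgue (\<lambda>t. norm (f t) powr p)"

definition in_Linfty :: "(real \<Rightarrow> complex) \<Rightarrow> bool" where
  "in_Linfty f \<longleftrightarrow>
     f \<in> borel_measurable lebesgue \<and> (\<exists>C. AE t in lebesgue. norm (f t) \<le> C)"

definition STFT :: "(real \<Rightarrow> complex) \<Rightarrow> (real \<Rightarrow> complex) \<Rightarrow> real \<Rightarrow> real \<Rightarrow> complex" where
  "STFT g f x \<xi> =
     (LINT t|lebesgue. f t * cnj (g (t - x)) * exp (- 2 * of_real pi * \<i> * of_real (\<xi> * t)))"

text \<open>
  The series is a pointwise sum over the integers. For strictly increasing \<open>a\<close> at most
  one term is nonzero at each point, and the value at the breakpoints \<open>a k\<close> is \<open>0\<close>.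
\<close>

definition step_fun :: "(int \<Rightarrow> real) \<Rightarrow> (int \<Rightarrow> real) \<Rightarrow> real \<Rightarrow> complex" where
  "step_fun a c t =
     (\<Sum>\<^sub>\<infinity>k\<in>UNIV. of_real (c k) * indicator {a k <..< a (k + 1)} t)"

end

theory Submission
  imports Defs
begin

text \<open>
  A window of length \<open>1\<close> starting at \<open>x\<close> meets (up to empty pieces) three consecutive levels \<open>c0, c1, c2\<close> of the
  step function and two breakpoints \<open>b1 < b2\<close> in between. Integrating the character
  \<open>E t = exp (- 2 * pi * \<i> * \<xi> * t)\<close> over the three pieces shows that, for \<open>\<xi> \<noteq> 0\<close>, the transform
  vanishes at \<open>(x, \<xi>)\<close> if and only if
  \<open>c0 * E x + (c1 - c0) * E b1 + (c2 - c1) * E b2 = c2 * E (x + 1)\<close>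
  (\<open>STFT_step_zero_iff\<close>).

  If the levels are strictly monotonic, this is an equality case of the triangle inequality:
  rearranged with positive coefficients, the two sides have the same total weight. So all four
  phases coincide, which makes \<open>\<xi>\<close> and \<open>\<xi> * (b2 - b1)\<close> integers and contradicts the
  irrationality of the gap (\<open>STFT_step_nonzero\<close>). Monotonic means strictly monotonic here; for
  constant levels \<open>\<xi> = 1\<close> is a zero.

  If the step function is in some \<open>L\<^sup>p\<close>, its levels cannot stay away from zero on a half-line, so
  somewhere \<open>c0 \<le> c1\<close> and \<open>c2 < c1\<close> (\<open>peak_if_in_Lp\<close>). At such a peak the equation says that two
  pairs of vectors, each of total length \<open>c1\<close>, have the same sum. Closing a triangle by the law of
  cosines gives a continuous one-parameter family of phases that satisfy it
  (\<open>peak_phase_curve\<close>). Phases coming from a frequency \<open>\<xi>\<close> are subject to one constraint, that the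
  phases over the lengths \<open>b2 - b1\<close> and \<open>1\<close> lie on a line winding around the torus with irrational
  slope. This line is dense by Kronecker's theorem, and the family of solutions moves across the
  direction of the line, so by the intermediate value theorem they meet, even at arbitrarily high
  frequency. The high frequency in turn leaves room to choose \<open>x\<close> (\<open>STFT_step_zero_at_peak\<close>).
\<close>

section \<open>Step functions on increasing partitions\<close>

lemma strict_mono_int_step:
  fixes a :: "int \<Rightarrow> 'a::order"
  assumes "\<And>k. a k < a (k + 1)"
  shows "strict_mono a"
proof (rule strict_monoI)
  fix i j :: int
  assume "i < j"
  then show "a i < a j"
    by (induction j rule: int_gr_induct) (auto intro: assms less_trans)
qed

lemma step_fun_between:
  assumes "strict_mono a" "t \<in> {a k<..<a (k + 1)}"
  shows "step_fun a c t = c k"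
proof -
  have "t \<notin> {a j<..<a (j + 1)}" if "j \<noteq> k" for j
  proof (cases "j < k")
    case True
    then have "a (j + 1) \<le> a k" using assms(1) by (simp add: strict_mono_less_eq)
    then show ?thesis using assms(2) by auto
  next
    case False
    then have "a (k + 1) \<le> a j" using assms(1) that by (simp add: strict_mono_less_eq)
    then show ?thesis using assms(2) by auto
  qed
  then have "((\<lambda>j. complex_of_real (c j) * indicator {a j<..<a (j + 1)} t) has_sum of_real (c k)) UNIV"
    using assms(2) by (intro has_sum_finite_neutralI[of "{k}"]) auto
  then show ?thesis unfolding step_fun_def by (rule infsumI)
qed

lemma step_fun_breakpoint:
  assumes "strict_mono a"
  shows "step_fun a c (a k) = 0"
proof -
  have "a k \<notin> {a j<..<a (j + 1)}" for j
    using assms by (auto simp: strict_mono_less)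
  then show ?thesis unfolding step_fun_def by (auto intro: infsum_0)
qed

section \<open>Fourier integrals of intervals\<close>

text \<open>
  The character of frequency \<open>\<xi>\<close>, in the form with \<^const>\<open>cis\<close>, for which
  phases can be added and compared modulo full turns.
\<close>

definition wave :: "real \<Rightarrow> real \<Rightarrow> complex" where
  "wave \<xi> t = cis (- 2 * pi * \<xi> * t)"

lemma norm_wave [simp]: "norm (wave \<xi> t) = 1"
  by (simp add: wave_def)

lemma wave_add: "wave \<xi> (s + t) = wave \<xi> s * wave \<xi> t"
  by (simp add: wave_def cis_mult algebra_simps)

text \<open>
  This turns coincidences of phases into arithmetic: for \<open>\<xi> \<noteq> 0\<close>, a coincidence over a distance
  \<open>1\<close> together with one over a gap of the partition makes the gap rational.
\<close>

lemma wave_eq_iff: "wave \<xi> s = wave \<xi> t \<longleftrightarrow> \<xi> * (t - s) \<in> \<int>"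
proof -
  have "wave \<xi> s = wave \<xi> t \<longleftrightarrow> cis (2 * pi * (\<xi> * (t - s))) = 1"
  proof -
    have "wave \<xi> s = wave \<xi> t \<longleftrightarrow> wave \<xi> s / wave \<xi> t = 1"
      by (metis norm_wave norm_zero right_inverse_eq zero_neq_one)
    also have "wave \<xi> s / wave \<xi> t = cis (2 * pi * (\<xi> * (t - s)))"
      by (simp add: wave_def cis_divide algebra_simps)
    finally show ?thesis .
  qed
  also have "\<dots> \<longleftrightarrow> (\<exists>n::int. 2 * pi * (\<xi> * (t - s)) = of_int (2 * n) * pi)"
    by (simp add: cis_conv_exp exp_eq_1)
  also have "\<dots> \<longleftrightarrow> (\<exists>n::int. \<xi> * (t - s) = of_int n)"
    by simp
  finally show ?thesis by (auto simp: Ints_def)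
qed

text \<open>
  The Fourier transform at \<open>\<xi>\<close> of the indicator of the interval from \<open>u\<close> to \<open>v\<close>.
\<close>

definition wave_integral :: "real \<Rightarrow> real \<Rightarrow> real \<Rightarrow> complex" where
  "wave_integral \<xi> u v =
     (if \<xi> = 0 then of_real (v - u) else (wave \<xi> u - wave \<xi> v) / (2 * pi * \<i> * \<xi>))"

lemma has_integral_wave:
  assumes "u \<le> v"
  shows "has_bochner_integral lebesgue (\<lambda>t. indicator {u<..<v} t * wave \<xi> t) (wave_integral \<xi> u v)"
proof -
  define F where "F t = (if \<xi> = 0 then of_real t else - wave \<xi> t / (2 * pi * \<i> * \<xi>))" for t
  have F: "(F has_vector_derivative wave \<xi> t) (at t within {u..v})" for t
  proof (cases "\<xi> = 0")
    case True
    then show ?thesis unfolding F_def wave_def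
      by (auto intro!: derivative_eq_intros simp: has_vector_derivative_def scaleR_conv_of_real)
  next
    case False
    have "((\<lambda>z. - exp (- 2 * pi * \<i> * \<xi> * z) / (2 * pi * \<i> * \<xi>)) has_field_derivative
       exp (- 2 * pi * \<i> * \<xi> * of_real t)) (at (of_real t))"
      using False by (auto intro!: derivative_eq_intros)
    from has_vector_derivative_real_field[OF this, of "{u..v}"]
    show ?thesis using False
      by (simp add: F_def[abs_def] wave_def cis_conv_exp mult_ac)
  qed
  have cont: "continuous_on S (wave \<xi>)" for S
    unfolding wave_def by (intro continuous_intros)
  then have [measurable]: "wave \<xi> \<in> borel_measurable borel"
    by (intro borel_measurable_continuous_onI)
  have "has_bochner_integral lborel (\<lambda>t. indicator {u..v} t *\<^sub>R wave \<xi> t) (F v - F u)"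
    using assms F cont by (intro has_bochner_integral_FTC_Icc) auto
  also have "F v - F u = wave_integral \<xi> u v"
    by (simp add: F_def wave_integral_def diff_divide_distrib)
  also have "has_bochner_integral lborel (\<lambda>t. indicator {u..v} t *\<^sub>R wave \<xi> t) (wave_integral \<xi> u v)
    \<longleftrightarrow> has_bochner_integral lborel (\<lambda>t. indicator {u<..<v} t * wave \<xi> t) (wave_integral \<xi> u v)"
  proof (rule has_bochner_integral_cong_AE)
    have "AE t in lborel. t \<noteq> u \<and> t \<noteq> v"
      using AE_lborel_singleton[of u] AE_lborel_singleton[of v] by eventually_elim auto
    then show "AE t in lborel. indicator {u..v} t *\<^sub>R wave \<xi> t = indicator {u<..<v} t * wave \<xi> t"
      by eventually_elim (auto split: split_indicator)
  qed measurable
  finally show ?thesis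
    by (auto simp: has_bochner_integral_iff integral_completion integrable_completion)
qed

section \<open>The short-time Fourier transform of a two-periodic step function\<close>

text \<open>
  The breakpoints \<open>k\<close> and \<open>k + \<alpha>\<close> have two features that matter: their two gaps are
  irrational, and moving on by two indices is moving on by the length \<open>1\<close> of the window.
  Stated in this way, windows that start in an even or in an odd step need no separate treatment.
\<close>

locale interlaced_steps =
  fixes a c :: "int \<Rightarrow> real"
  assumes a_less: "a k < a (k + 1)"
    and a_period: "a (k + 2) = a k + 1"
    and gap_irrational: "a (k + 1) - a k \<notin> \<rat>"
    and c_pos: "c k > 0"
begin

lemma strict_mono_a: "strict_mono a"
  by (intro strict_mono_int_step a_less)

lemma a_even_index: "a (2 * n) = a 0 + of_int n"
proof (induction n rule: int_induct[where k=0])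
  case (step1 i)
  then show ?case using a_period[of "2 * i"] by (simp add: algebra_simps)
next
  case (step2 i)
  then show ?case using a_period[of "2 * (i - 1)"] by (simp add: algebra_simps)
qed simp

lemma partition_covers:
  obtains k where "a k \<le> t" "t < a (k + 1)"
proof -
  define n where "n = \<lfloor>t - a 0\<rfloor>"
  have "a (2 * n) \<le> t" "t < a (2 * n + 2)"
    using a_period[of "2 * n"] by (auto simp: a_even_index n_def) linarith+
  then show thesis
    using that[of "2 * n"] that[of "2 * n + 1"] by (cases "t < a (2 * n + 1)") (auto simp: add.assoc)
qed

abbreviation step where "step \<equiv> step_fun a c"

text \<open>
  If the left end of the window lies in step \<open>k\<close>, then periodicity puts the right end in
  step \<open>k + 2\<close>, so three levels are enough. If \<open>x\<close> is itself a breakpoint, one of the outer pieces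
  is empty.
  The equality of the integrands is pointwise, because both sides vanish at breakpoints.
\<close>

lemma STFT_step:
  assumes x: "a k \<le> x" "x \<le> a (k + 1)"
  shows "STFT (indicator {0<..<1}) step x \<xi> =
    c k * wave_integral \<xi> x (a (k + 1)) + c (k + 1) * wave_integral \<xi> (a (k + 1)) (a (k + 2))
    + c (k + 2) * wave_integral \<xi> (a (k + 2)) (x + 1)"
proof -
  \<comment> \<open>After absorbing the window, the integrand is a combination of truncated characters.\<close>
  define l where "l u v t = indicator {u<..<v} t * wave \<xi> t" for u v t
  have ord: "a (k + 1) < a (k + 2)" "a (k + 2) \<le> x + 1" "x + 1 \<le> a (k + 3)"
    using a_less[of "k + 1"] a_period[of k] a_period[of "k + 1"] x by (auto simp: algebra_simps)
  have "step t * cnj (indicator {0<..<1} (t - x)) * exp (- 2 * of_real pi * \<i> * of_real (\<xi> * t)) =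
     c k * l x (a (k + 1)) t + c (k + 1) * l (a (k + 1)) (a (k + 2)) t + c (k + 2) * l (a (k + 2)) (x + 1) t"
    (is "?L t = ?R t") for t
  proof -
    have L: "?L t = step t * indicator {x<..<x+1} t * wave \<xi> t"
      by (auto simp: wave_def cis_conv_exp mult_ac split: split_indicator)
    consider "t \<le> x \<or> x + 1 \<le> t" | "t = a (k + 1)" | "t = a (k + 2)" |
       "x < t" "t < a (k + 1)" | "a (k + 1) < t" "t < a (k + 2)" | "a (k + 2) < t" "t < x + 1"
      by linarith
    then show ?thesis
    proof cases
      case 1
      then show ?thesis unfolding L l_def using x ord by auto
    next
      case 2
      then show ?thesis unfolding L l_def using x ord step_fun_breakpoint[OF strict_mono_a] by auto
    next
      case 3
      then show ?thesis unfolding L l_def using x ord step_fun_breakpoint[OF strict_mono_a] by auto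
    next
      case 4
      then show ?thesis unfolding L l_def using x ord step_fun_between[OF strict_mono_a, of t k] by auto
    next
      case 5
      then show ?thesis unfolding L l_def
        using x ord step_fun_between[OF strict_mono_a, of t "k + 1"] by (auto simp: add.assoc)
    next
      case 6
      then show ?thesis unfolding L l_def
        using x ord step_fun_between[OF strict_mono_a, of t "k + 2"] by (auto simp: add.assoc)
    qed
  qed
  then have "STFT (indicator {0<..<1}) step x \<xi> = (LINT t|lebesgue. ?R t)"
    unfolding STFT_def by simp
  also have "has_bochner_integral lebesgue ?R
    (c k * wave_integral \<xi> x (a (k + 1)) + c (k + 1) * wave_integral \<xi> (a (k + 1)) (a (k + 2))
      + c (k + 2) * wave_integral \<xi> (a (k + 2)) (x + 1))"
    unfolding l_def using x ord
    by (intro has_bochner_integral_add has_bochner_integral_mult_right has_integral_wave) auto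
  then have "(LINT t|lebesgue. ?R t) =
    c k * wave_integral \<xi> x (a (k + 1)) + c (k + 1) * wave_integral \<xi> (a (k + 1)) (a (k + 2))
      + c (k + 2) * wave_integral \<xi> (a (k + 2)) (x + 1)"
    by (rule has_bochner_integral_integral_eq)
  finally show ?thesis .
qed

text \<open>
  Summation by parts. A zero of the transform is a coincidence between four unit vectors, weighted
  by the two outer levels and by the two jumps; both parts of the theorem are about this equation.
\<close>

lemma STFT_step_zero_iff:
  assumes x: "a k \<le> x" "x \<le> a (k + 1)" and "\<xi> \<noteq> 0"
  shows "STFT (indicator {0<..<1}) step x \<xi> = 0 \<longleftrightarrow>
    c k * wave \<xi> x + (c (k + 1) - c k) * wave \<xi> (a (k + 1)) + (c (k + 2) - c (k + 1)) * wave \<xi> (a (k + 2))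
     = c (k + 2) * wave \<xi> (x + 1)"
  unfolding STFT_step[OF x] wave_integral_def using \<open>\<xi> \<noteq> 0\<close>
  by (simp add: field_simps add_divide_distrib[symmetric] diff_divide_distrib[symmetric])

lemma STFT_step_frequency_zero: "STFT (indicator {0<..<1}) step x 0 \<noteq> 0"
proof -
  obtain k where x: "a k \<le> x" "x < a (k + 1)" by (rule partition_covers)
  have ord: "a (k + 1) < a (k + 2)" "a (k + 2) \<le> x + 1"
    using a_less[of "k + 1"] a_period[of k] x by (auto simp: algebra_simps)
  have "STFT (indicator {0<..<1}) step x 0 =
     complex_of_real (c k * (a (k + 1) - x) + c (k + 1) * (a (k + 2) - a (k + 1)) + c (k + 2) * (x + 1 - a (k + 2)))"
    using STFT_step[of k x 0] x by (simp add: wave_integral_def)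
  moreover have "c k * (a (k + 1) - x) + c (k + 1) * (a (k + 2) - a (k + 1)) + c (k + 2) * (x + 1 - a (k + 2)) > 0"
    using ord x c_pos by (intro add_pos_nonneg mult_pos_pos mult_nonneg_nonneg) (auto intro: less_imp_le)
  ultimately show ?thesis
    by (metis less_irrefl of_real_eq_0_iff)
qed

end

section \<open>Monotonic levels: no zeros\<close>

text \<open>
  Equality in the triangle inequality: the real parts \<open>Re (u i * cnj z)\<close> are at most \<open>1\<close>
  and their weighted mean is \<open>1\<close>, so each of them is \<open>1\<close>.
\<close>

lemma unit_eq_if_weighted_sum_eq:
  fixes u :: "'i \<Rightarrow> complex" and p :: "'i \<Rightarrow> real" and z :: complex
  assumes "finite I" "\<And>i. i \<in> I \<Longrightarrow> p i > 0" "\<And>i. i \<in> I \<Longrightarrow> norm (u i) = 1"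
    and "norm z = 1" and eq: "(\<Sum>i\<in>I. p i * u i) = (\<Sum>i\<in>I. p i) * z" and "i \<in> I"
  shows "u i = z"
proof -
  have zz: "z * cnj z = 1"
    using \<open>norm z = 1\<close> by (simp flip: complex_norm_square)
  define d where "d j = p j * (1 - Re (u j * cnj z))" for j
  have norm1: "norm (u j * cnj z) = 1" if "j \<in> I" for j
    using assms that by (simp add: norm_mult)
  have "d j \<ge> 0" if "j \<in> I" for j
    using complex_Re_le_cmod[of "u j * cnj z"] norm1[OF that] assms(2)[OF that] by (simp add: d_def)
  moreover have "(\<Sum>j\<in>I. d j) = 0"
  proof -
    have "(\<Sum>j\<in>I. p j * Re (u j * cnj z)) = Re ((\<Sum>j\<in>I. p j * u j) * cnj z)"
      by (simp add: sum_distrib_right mult.assoc sum_subtractf right_diff_distrib)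
    also have "\<dots> = (\<Sum>j\<in>I. p j)"
      unfolding eq using zz by (simp add: mult.assoc)
    finally show ?thesis by (simp add: d_def right_diff_distrib sum_subtractf)
  qed
  ultimately have "d i = 0" using sum_nonneg_eq_0_iff[OF \<open>finite I\<close>] \<open>i \<in> I\<close> by blast
  then have "Re (u i * cnj z) = 1" using assms(2)[OF \<open>i \<in> I\<close>] by (simp add: d_def)
  moreover from this have "Im (u i * cnj z) = 0"
    using norm1[OF \<open>i \<in> I\<close>] by (auto simp: cmod_def)
  ultimately have "u i * cnj z = 1" by (simp add: complex_eq_iff)
  moreover have "u i * cnj z * z = u i" using zz by (simp add: mult.assoc mult.commute)
  ultimately show ?thesis by simp
qed

lemma unit_eq_if_weighted_sum3_eq:
  fixes p q r s :: real and u v w z :: complex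
  assumes "p > 0" "q > 0" "r > 0" "norm u = 1" "norm v = 1" "norm w = 1" "norm z = 1"
    and "p * u + q * v + r * w = s * z" "s = p + q + r"
  shows "u = z" "v = z" "w = z"
proof -
  have *: "[u, v, w] ! i = z" if "i \<in> {..<3}" for i
  proof (rule unit_eq_if_weighted_sum_eq[OF _ _ _ _ _ that])
    show "(\<Sum>i<3. ([p, q, r] ! i) * ([u, v, w] ! i)) = (\<Sum>i<3. [p, q, r] ! i) * z"
      using assms by (simp add: numeral_3_eq_3 algebra_simps)
  qed (use assms in \<open>auto simp: less_Suc_eq numeral_3_eq_3\<close>)
  show "u = z" "v = z" "w = z"
    using *[of 0] *[of 1] *[of 2] by auto
qed

context interlaced_steps begin

lemma gap_phases_irrational:
  assumes "\<xi> \<noteq> 0" "wave \<xi> x = wave \<xi> (x + 1)"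
  shows "wave \<xi> (a k) \<noteq> wave \<xi> (a (k + 1))"
proof
  assume "wave \<xi> (a k) = wave \<xi> (a (k + 1))"
  then obtain m where "\<xi> * (a (k + 1) - a k) = of_int m" by (auto simp: wave_eq_iff Ints_def)
  moreover obtain n where "\<xi> = of_int n" using assms(2) by (auto simp: wave_eq_iff Ints_def)
  ultimately have "a (k + 1) - a k = of_int m / of_int n" using \<open>\<xi> \<noteq> 0\<close> by (auto simp: field_simps)
  then show False using gap_irrational[of k] by simp
qed

text \<open>
  For strictly monotonic levels the jumps have one sign, so after moving one outer term to the
  other side all weights are positive and balance. Then the triangle inequality is an equality,
  all four phases agree, and the nonzero frequency and its product with an irrational gap would
  both be integers. At frequency \<open>0\<close> the transform is the integral of a positive function.
\<close>

lemma STFT_step_nonzero: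
  assumes "strict_mono c \<or> strict_antimono_on UNIV c"
  shows "STFT (indicator {0<..<1}) step x \<xi> \<noteq> 0"
proof (cases "\<xi> = 0")
  case True
  then show ?thesis by (simp add: STFT_step_frequency_zero)
next
  case False
  obtain k where k: "a k \<le> x" "x < a (k + 1)" by (rule partition_covers)
  show ?thesis
  proof
    assume "STFT (indicator {0<..<1}) step x \<xi> = 0"
    then have eq: "c k * wave \<xi> x + (c (k + 1) - c k) * wave \<xi> (a (k + 1))
        + (c (k + 2) - c (k + 1)) * wave \<xi> (a (k + 2)) = c (k + 2) * wave \<xi> (x + 1)"
      using STFT_step_zero_iff[of k x \<xi>] k False by simp
    have "wave \<xi> x = wave \<xi> (x + 1) \<and> wave \<xi> (a (k + 1)) = wave \<xi> (a (k + 2))"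
      using assms
    proof
      assume "strict_mono c"
      then have less: "c k < c (k + 1)" "c (k + 1) < c (k + 2)" by (auto simp: strict_mono_less)
      then show ?thesis
        using unit_eq_if_weighted_sum3_eq[OF _ _ _ _ _ _ _ eq] c_pos[of k] by simp
    next
      assume "strict_antimono_on UNIV c"
      then have less: "c (k + 1) < c k" "c (k + 2) < c (k + 1)"
        by (auto simp: monotone_on_def)
      have "c (k + 2) * wave \<xi> (x + 1) + (c k - c (k + 1)) * wave \<xi> (a (k + 1))
          + (c (k + 1) - c (k + 2)) * wave \<xi> (a (k + 2)) = c k * wave \<xi> x"
        unfolding eq[symmetric] by (simp add: algebra_simps)
      from unit_eq_if_weighted_sum3_eq[OF _ _ _ _ _ _ _ this]
      show ?thesis using less c_pos[of "k + 2"] by simp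
    qed
    then show False
      using gap_phases_irrational[OF False, of x "k + 1"] by (auto simp: add.assoc)
  qed
qed

section \<open>Measurability and boundedness\<close>

text \<open>
  The truncated sums over \<open>- n, \<dots>, n\<close> are measurable and are eventually constant at each
  point.
\<close>

lemma step_measurable: "step \<in> borel_measurable borel"
proof (rule borel_measurable_LIMSEQ_metric)
  fix n :: nat
  show "(\<lambda>t. \<Sum>k\<in>{- int n..int n}. complex_of_real (c k) * indicator {a k<..<a (k + 1)} t) \<in> borel_measurable borel"
    by measurable
next
  fix t
  obtain j where j: "a j \<le> t" "t < a (j + 1)" by (rule partition_covers)
  have "(\<Sum>k\<in>{- int n..int n}. complex_of_real (c k) * indicator {a k<..<a (k + 1)} t) = step t"
    if n: "n \<ge> nat \<bar>j\<bar>" for n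
    unfolding step_fun_def
  proof (rule sym, rule infsumI, rule has_sum_finite_neutralI)
    fix k assume "k \<in> UNIV - {- int n..int n}"
    then have "k \<noteq> j" using n by auto
    have "t \<notin> {a k<..<a (k + 1)}"
    proof
      assume t: "t \<in> {a k<..<a (k + 1)}"
      then have "a k < a (j + 1)" "a j < a (k + 1)" using j by auto
      then have "k < j + 1" "j < k + 1" using strict_mono_a by (simp_all add: strict_mono_less)
      then show False using \<open>k \<noteq> j\<close> by simp
    qed
    then show "complex_of_real (c k) * indicator {a k<..<a (k + 1)} t = 0" by simp
  qed auto
  then show "(\<lambda>n. \<Sum>k\<in>{- int n..int n}. complex_of_real (c k) * indicator {a k<..<a (k + 1)} t) \<longlonglongrightarrow> step t"
    by (intro tendsto_eventually eventually_sequentiallyI[of "nat \<bar>j\<bar>"]) auto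
qed

lemma step_values: "(\<exists>k. a k < t \<and> t < a (k + 1) \<and> step t = c k) \<or> (\<exists>k. t = a k)"
proof -
  obtain k where "a k \<le> t" "t < a (k + 1)" by (rule partition_covers)
  then show ?thesis using step_fun_between[OF strict_mono_a, of t k c] by (cases "t = a k") (auto intro!: exI[of _ k])
qed

lemma in_Linfty_step:
  assumes "bounded (range c)"
  shows "in_Linfty step"
proof -
  obtain C where C: "\<And>k. \<bar>c k\<bar> \<le> C" using assms by (auto simp: bounded_iff)
  then have "0 \<le> C" by (meson abs_ge_zero order_trans)
  then have "norm (step t) \<le> C" for t
    using step_values[of t] C step_fun_breakpoint[OF strict_mono_a, of c] by auto
  moreover have "step \<in> borel_measurable lebesgue"
    using step_measurable by (intro measurable_completion) simp
  ultimately show ?thesis unfolding in_Linfty_def by auto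
qed

end

section \<open>Integrable step functions have a peak\<close>

lemma emeasure_lborel_eq_infinity:
  assumes "J \<in> sets borel" "\<And>n::nat. \<exists>u. {u..u + real n} \<subseteq> J"
  shows "emeasure lborel J = \<infinity>"
proof (rule ccontr)
  assume "emeasure lborel J \<noteq> \<infinity>"
  then obtain n where n: "emeasure lborel J < of_nat n"
    using ennreal_Ex_less_of_nat[of "emeasure lborel J"] by (auto simp: less_top)
  obtain u where "{u..u + real n} \<subseteq> J" using assms(2) by blast
  then have "emeasure lborel {u..u + real n} \<le> emeasure lborel J"
    using assms(1) by (intro emeasure_mono) auto
  then show False using n by (simp add: ennreal_of_nat_eq_real_of_nat)
qed

context interlaced_steps begin

lemma not_in_Lp_if_bounded_below:
  assumes "\<epsilon> > 0" and p: "p \<ge> 1" and J: "emeasure lborel J = \<infinity>" "J \<in> sets borel"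
    and ge: "\<And>k t. t \<in> J \<Longrightarrow> a k < t \<Longrightarrow> t < a (k + 1) \<Longrightarrow> \<epsilon> \<le> c k"
  shows "\<not> in_Lp p step"
proof
  assume "in_Lp p step"
  then have int: "integrable lebesgue (\<lambda>t. norm (step t) powr p)" by (simp add: in_Lp_def)
  have "AE t in lborel. t \<notin> range a"
    by (intro AE_not_in countable_imp_null_set_lborel) auto
  then have "AE t in lborel. norm (indicator J t * \<epsilon> powr p) \<le> norm (norm (step t) powr p)"
  proof eventually_elim
    case (elim t)
    show ?case
    proof (cases "t \<in> J")
      case True
      then obtain k where "a k < t" "t < a (k + 1)" "step t = c k"
        using step_values[of t] elim by auto
      then have "\<epsilon> \<le> norm (step t)" using ge[OF True] by fastforce
      then show ?thesis using True \<open>\<epsilon> > 0\<close> p by (simp add: powr_mono2)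
    qed simp
  qed
  then have "AE t in lebesgue. norm (indicator J t * \<epsilon> powr p) \<le> norm (norm (step t) powr p)"
    by (rule AE_completion)
  moreover have meas: "(\<lambda>t. indicator J t * \<epsilon> powr p) \<in> borel_measurable lborel"
    using J by measurable
  ultimately have "integrable lebesgue (\<lambda>t. indicator J t * \<epsilon> powr p)"
    by (intro Bochner_Integration.integrable_bound[OF int] measurable_completion)
  then have "integrable lborel (\<lambda>t. indicator J t * \<epsilon> powr p)"
    by (simp only: integrable_completion[OF meas])
  then have "integrable lborel (indicator J :: real \<Rightarrow> real)"
    using \<open>\<epsilon> > 0\<close> by simp
  then show False using J by (simp add: integrable_indicator_iff)
qed

text \<open>
  Without a peak, an ascent would be followed by ascents for ever, so the levels either ascend
  from some index on or descend everywhere. Either way they stay at or above a positive constant on a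
  half-line, so no positive power of the step function is integrable. The asymmetry between the weak and
  the strict inequality serves the triangles below, which have a side of length \<open>c1 - c2\<close>.
\<close>

lemma peak_if_in_Lp:
  assumes "in_Lp p step" "p \<ge> 1"
  shows "\<exists>k. c k \<le> c (k + 1) \<and> c (k + 2) < c (k + 1)"
proof (rule ccontr)
  assume "\<nexists>k. c k \<le> c (k + 1) \<and> c (k + 2) < c (k + 1)"
  then have *: "c (k + 1) \<le> c (k + 2)" if "c k \<le> c (k + 1)" for k
    using that by (auto simp: not_less)
  show False
  proof (cases "\<exists>k. c k \<le> c (k + 1)")
    case True
    then obtain k where k: "c k \<le> c (k + 1)" by blast
    have up: "c j \<le> c (j + 1)" if "k \<le> j" for j
      using that
    proof (induction j rule: int_ge_induct)
      case (step i)
      then show ?case using *[of i] by (simp add: add.assoc)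
    qed (use k in auto)
    have "c k \<le> c j" if "k \<le> j" for j
      using that
    proof (induction j rule: int_ge_induct)
      case (step i)
      then show ?case using up[of i] by linarith
    qed simp
    then have above: "c k \<le> c j" if "a k \<le> t" "t < a (j + 1)" for j t
      using that strict_mono_less[OF strict_mono_a, of k "j + 1"] by force
    moreover have "emeasure lborel {a k..} = \<infinity>"
      by (rule emeasure_lborel_eq_infinity) (auto intro!: exI[of _ "a k"])
    ultimately have "\<not> in_Lp p step"
      using assms(2) c_pos[of k]
      by (intro not_in_Lp_if_bounded_below[of "c k" p "{a k..}"]) (auto intro: above)
    then show False using assms(1) by simp
  next
    case False
    have "c 0 \<le> c j" if "j \<le> 0" for j
      using that
    proof (induction j rule: int_le_induct)
      case (step i)
      have "\<not> c (i - 1) \<le> c (i - 1 + 1)" using False by blast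
      then show ?case using step by simp
    qed simp
    then have below: "c 0 \<le> c j" if "t \<le> a 0" "a j < t" for j t
      using that strict_mono_less[OF strict_mono_a, of j 0] by force
    moreover have "emeasure lborel {..a 0} = \<infinity>"
    proof (rule emeasure_lborel_eq_infinity)
      show "\<exists>u. {u..u + real n} \<subseteq> {..a 0}" for n
        by (auto intro!: exI[of _ "a 0 - real n"])
    qed auto
    ultimately have "\<not> in_Lp p step"
      using assms(2) c_pos[of 0]
      by (intro not_in_Lp_if_bounded_below[of "c 0" p "{..a 0}"]) (auto intro: below)
    then show False using assms(1) by simp
  qed
qed

end

section \<open>A curve of phases at a peak\<close>

lemma upper_half_plane_polar:
  assumes "z \<noteq> 0" "Im z \<ge> 0"
  shows "z = norm z * cis (arccos (Re z / norm z))"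
proof -
  have r: "norm z > 0" using assms by simp
  have le: "\<bar>Re z / norm z\<bar> \<le> 1" using r abs_Re_le_cmod[of z] by (simp add: divide_le_eq)
  define X where "X = Re z / norm z"
  have X: "\<bar>X\<bar> \<le> 1" "norm z * X = Re z" using le r by (auto simp: X_def)
  then have X2: "1 - X\<^sup>2 \<ge> 0" by (simp add: abs_square_le_1)
  have Im: "norm z * sqrt (1 - X\<^sup>2) = Im z"
  proof (rule power2_eq_imp_eq)
    have "(norm z * sqrt (1 - X\<^sup>2))\<^sup>2 = (norm z)\<^sup>2 - (norm z * X)\<^sup>2"
      using X2 by (simp add: power_mult_distrib right_diff_distrib)
    also have "\<dots> = (Im z)\<^sup>2" by (simp add: X cmod_power2)
    finally show "(norm z * sqrt (1 - X\<^sup>2))\<^sup>2 = (Im z)\<^sup>2" .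
  qed (use assms X2 in auto)
  have "Re (norm z * cis (arccos X)) = Re z" "Im (norm z * cis (arccos X)) = Im z"
    using X Im by (simp_all add: sin_arccos_abs cos_arccos_abs)
  then show ?thesis unfolding X_def by (intro complex_eqI) simp_all
qed

lemma cosine_law_bounds:
  fixes p q r :: real
  assumes "p > 0" "r > 0" "\<bar>p - q\<bar> \<le> r" "r \<le> p + q"
  shows "\<bar>(r\<^sup>2 + p\<^sup>2 - q\<^sup>2) / (2 * r * p)\<bar> \<le> 1"
proof -
  have "(r - p)\<^sup>2 \<le> q\<^sup>2" using assms by (intro abs_le_square_iff[THEN iffD1]) linarith
  moreover have "q\<^sup>2 \<le> (r + p)\<^sup>2" using assms by (intro abs_le_square_iff[THEN iffD1]) linarith
  ultimately have "\<bar>r\<^sup>2 + p\<^sup>2 - q\<^sup>2\<bar> \<le> 2 * r * p" by (simp add: power2_eq_square algebra_simps abs_le_iff)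
  then show ?thesis using assms by (simp add: divide_le_eq)
qed

text \<open>
  The angle between the sides \<open>r\<close> and \<open>p\<close> of a triangle with sides \<open>p, q, r\<close>, by the law
  of cosines.
\<close>

definition triangle_angle :: "real \<Rightarrow> real \<Rightarrow> real \<Rightarrow> real" where
  "triangle_angle p q r = arccos ((r\<^sup>2 + p\<^sup>2 - q\<^sup>2) / (2 * r * p))"

text \<open>
  A triangle with base \<open>r\<close> on the real axis: its sides \<open>p\<close> and \<open>q\<close> leave the axis on
  opposite sides, so the imaginary parts cancel because both give the height of the triangle.
\<close>

lemma triangle_closes:
  fixes p q r :: real
  assumes "p > 0" "q > 0" "r > 0" "\<bar>p - q\<bar> \<le> r" "r \<le> p + q"
  shows "p * cis (- triangle_angle p q r) + q * cis (triangle_angle q p r) = r"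
proof -
  define X where "X = (r\<^sup>2 + p\<^sup>2 - q\<^sup>2) / (2 * r * p)"
  define Y where "Y = (r\<^sup>2 + q\<^sup>2 - p\<^sup>2) / (2 * r * q)"
  have X: "\<bar>X\<bar> \<le> 1" unfolding X_def using assms by (intro cosine_law_bounds) auto
  have Y: "\<bar>Y\<bar> \<le> 1" unfolding Y_def using assms by (intro cosine_law_bounds) auto
  have Re: "p * X + q * Y = r"
    using assms unfolding X_def Y_def by (simp add: field_simps power2_eq_square)
  have squares: "p\<^sup>2 * (1 - X\<^sup>2) = q\<^sup>2 * (1 - Y\<^sup>2)"
  proof -
    have "2 * r * (p * X) = r\<^sup>2 + p\<^sup>2 - q\<^sup>2" "2 * r * (q * Y) = r\<^sup>2 + q\<^sup>2 - p\<^sup>2"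
      using assms by (simp_all add: X_def Y_def)
    then have "(2 * r)\<^sup>2 * ((p * X)\<^sup>2 - (q * Y)\<^sup>2) = (r\<^sup>2 + p\<^sup>2 - q\<^sup>2)\<^sup>2 - (r\<^sup>2 + q\<^sup>2 - p\<^sup>2)\<^sup>2"
      by (simp only: right_diff_distrib flip: power_mult_distrib)
    also have "\<dots> = (2 * r)\<^sup>2 * (p\<^sup>2 - q\<^sup>2)" by algebra
    finally have "(p * X)\<^sup>2 - (q * Y)\<^sup>2 = p\<^sup>2 - q\<^sup>2" using assms by simp
    then show ?thesis by (simp add: algebra_simps power_mult_distrib)
  qed
  have X2: "1 - X\<^sup>2 \<ge> 0" and Y2: "1 - Y\<^sup>2 \<ge> 0" using X Y by (auto simp: abs_square_le_1)
  have Im: "p * sqrt (1 - X\<^sup>2) = q * sqrt (1 - Y\<^sup>2)"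
  proof (rule power2_eq_imp_eq)
    show "(p * sqrt (1 - X\<^sup>2))\<^sup>2 = (q * sqrt (1 - Y\<^sup>2))\<^sup>2"
      using squares X2 Y2 by (simp add: power_mult_distrib)
  qed (use assms X2 Y2 in auto)
  show ?thesis
    unfolding triangle_angle_def X_def[symmetric] Y_def[symmetric]
    using X Y Re Im by (simp add: complex_eq_iff sin_arccos_abs cos_arccos_abs)
qed

text \<open>
  At a peak the zero equation reads
  \<open>c0 * cis s + (c1 - c0) = c2 * cis (s + \<psi>) + (c1 - c2) * cis \<theta>\<close>, where the weights on
  each side add up to \<open>c1\<close>. Here \<open>s\<close>, \<open>\<theta>\<close> and \<open>\<psi>\<close> are the phases gained from the first
  breakpoint to the left end of the window, over the middle step, and over a distance \<open>1\<close>.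
  As \<open>s\<close> grows from \<open>0\<close>, the left side \<open>w\<close> stays close to its maximal length \<open>c1\<close>,
  and it is the sum of two vectors of lengths \<open>c2\<close> and \<open>c1 - c2\<close> as soon as these and
  \<open>norm w\<close> satisfy the triangle inequality. Of the two mirror-image solutions the one with the
  vector of phase \<open>\<theta>\<close> ahead of \<open>w\<close> is taken; this gives the sign conditions, which later force
  \<open>\<theta> - \<beta> * \<psi>\<close> to leave zero.
\<close>

lemma peak_phase_curve:
  fixes c0 c1 c2 :: real
  assumes "0 < c0" "c0 \<le> c1" "0 < c2" "c2 < c1"
  obtains \<delta> :: real and \<theta> \<psi> :: "real \<Rightarrow> real" where
    "\<delta> > 0" "continuous_on {0..\<delta>} \<theta>" "continuous_on {0..\<delta>} \<psi>" "\<theta> 0 = 0" "\<psi> 0 = 0"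
    and "\<And>s. s \<in> {0..\<delta>} \<Longrightarrow> 0 \<le> \<theta> s \<and> s + \<psi> s \<le> \<theta> s \<and> \<bar>\<psi> s\<bar> \<le> 2 * pi"
    and "\<And>s. s \<in> {0..\<delta>} \<Longrightarrow>
           c0 * cis s + (c1 - c0) = c2 * cis (s + \<psi> s) + (c1 - c2) * cis (\<theta> s)"
proof -
  define w where "w s = c0 * cis s + (c1 - c0)" for s
  define r where "r s = norm (w s)" for s
  have r0: "w 0 = c1" "r 0 = c1" using assms by (auto simp: r_def w_def)
  have cont_w: "continuous_on S w" for S unfolding w_def by (intro continuous_intros)
  then have cont_r: "continuous_on S r" for S unfolding r_def by (intro continuous_intros)
  have "c1 - \<bar>c2 - (c1 - c2)\<bar> > 0" using assms by linarith
  then obtain d where d: "d > 0" "\<And>s. \<bar>s\<bar> < d \<Longrightarrow> \<bar>r s - r 0\<bar> < c1 - \<bar>c2 - (c1 - c2)\<bar>"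
    using cont_r[of UNIV] unfolding continuous_on_iff dist_real_def by (metis UNIV_I diff_0_right)
  \<comment> \<open>The bound \<open>1 < pi\<close> keeps \<open>w\<close> in the upper half-plane, where \<^const>\<open>arccos\<close> gives its argument.\<close>
  define \<delta> where "\<delta> = min 1 (d / 2)"
  \<comment> \<open>\<open>\<omega>\<close> is the argument of \<open>w\<close>; \<open>A\<close> and \<open>B\<close> are the angles of the triangle with base \<open>w\<close>.\<close>
  define \<omega> where "\<omega> s = arccos (Re (w s) / r s)" for s
  define A where "A s = triangle_angle c2 (c1 - c2) (r s)" for s
  define B where "B s = triangle_angle (c1 - c2) c2 (r s)" for s
  have "\<delta> > 0" using d by (simp add: \<delta>_def)
  have near: "\<bar>c2 - (c1 - c2)\<bar> < r s" if "s \<in> {0..\<delta>}" for s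
    using d(2)[of s] d(1) that r0 by (auto simp: \<delta>_def)
  then have r_pos: "0 < r s" if "s \<in> {0..\<delta>}" for s using that by fastforce
  have r_le: "r s \<le> c2 + (c1 - c2)" for s
    using norm_triangle_ineq[of "c0 * cis s" "complex_of_real (c1 - c0)"] assms
    by (simp add: r_def w_def norm_mult del: of_real_diff)
  have bound_\<omega>: "-1 \<le> Re (w s) / r s \<and> Re (w s) / r s \<le> 1" if "s \<in> {0..\<delta>}" for s
    using r_pos[OF that] abs_Re_le_cmod[of "w s"] by (auto simp: r_def divide_le_eq le_divide_eq)
  have bound_A: "-1 \<le> ((r s)\<^sup>2 + c2\<^sup>2 - (c1 - c2)\<^sup>2) / (2 * r s * c2) \<and>
      ((r s)\<^sup>2 + c2\<^sup>2 - (c1 - c2)\<^sup>2) / (2 * r s * c2) \<le> 1" if "s \<in> {0..\<delta>}" for s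
    using cosine_law_bounds[of c2 "r s" "c1 - c2"] assms near[OF that] r_pos[OF that] r_le[of s]
    by linarith
  have bound_B: "-1 \<le> ((r s)\<^sup>2 + (c1 - c2)\<^sup>2 - c2\<^sup>2) / (2 * r s * (c1 - c2)) \<and>
      ((r s)\<^sup>2 + (c1 - c2)\<^sup>2 - c2\<^sup>2) / (2 * r s * (c1 - c2)) \<le> 1" if "s \<in> {0..\<delta>}" for s
    using cosine_law_bounds[of "c1 - c2" "r s" c2] assms near[OF that] r_pos[OF that] r_le[of s]
    by linarith
  have angles: "0 \<le> \<omega> s" "\<omega> s \<le> pi" "0 \<le> A s" "A s \<le> pi" "0 \<le> B s" if "s \<in> {0..\<delta>}" for s
    unfolding \<omega>_def A_def B_def triangle_angle_def
    using bound_\<omega>[OF that] bound_A[OF that] bound_B[OF that]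
    by (simp_all only: arccos_lbound arccos_ubound)
  have r_nz: "\<forall>s\<in>{0..\<delta>}. r s \<noteq> 0" using r_pos by force
  have cont_\<omega>: "continuous_on {0..\<delta>} \<omega>" unfolding \<omega>_def
    using bound_\<omega> r_nz by (intro continuous_intros cont_w cont_r) simp_all
  have cont_A: "continuous_on {0..\<delta>} A" unfolding A_def triangle_angle_def
    using bound_A r_nz assms by (intro continuous_intros cont_r) simp_all
  have cont_B: "continuous_on {0..\<delta>} B" unfolding B_def triangle_angle_def
    using bound_B r_nz assms by (intro continuous_intros cont_r) simp_all
  have zero: "\<omega> 0 = 0" "A 0 = 0" "B 0 = 0"
  proof -
    have "(c1\<^sup>2 + c2\<^sup>2 - (c1 - c2)\<^sup>2) / (2 * c1 * c2) = 1"
      "(c1\<^sup>2 + (c1 - c2)\<^sup>2 - c2\<^sup>2) / (2 * c1 * (c1 - c2)) = 1"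
      using assms by (auto simp: field_simps power2_eq_square)
    then show "A 0 = 0" "B 0 = 0"
      by (simp_all only: A_def B_def triangle_angle_def r0 arccos_1)
    show "\<omega> 0 = 0"
      using assms by (simp add: \<omega>_def r0)
  qed
  have eq: "w s = c2 * cis (\<omega> s - A s) + (c1 - c2) * cis (\<omega> s + B s)" if s: "s \<in> {0..\<delta>}" for s
  proof -
    have "0 \<le> s" "s \<le> pi" using s pi_gt3 by (auto simp: \<delta>_def)
    then have "0 \<le> sin s" by (rule sin_ge_zero)
    then have "Im (w s) \<ge> 0" using assms by (simp add: w_def)
    then have "w s = r s * cis (\<omega> s)"
      unfolding \<omega>_def r_def using r_pos[OF s] by (intro upper_half_plane_polar) (auto simp: r_def)
    also have "complex_of_real (r s) = c2 * cis (- A s) + (c1 - c2) * cis (B s)"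
      unfolding A_def B_def using triangle_closes[of c2 "c1 - c2" "r s"] assms near[OF s] r_pos[OF s] r_le[of s]
      by simp
    finally have "w s = c2 * (cis (- A s) * cis (\<omega> s)) + (c1 - c2) * (cis (B s) * cis (\<omega> s))"
      by (simp only: distrib_right mult.assoc)
    also have "cis (- A s) * cis (\<omega> s) = cis (\<omega> s - A s)" by (simp add: cis_mult)
    also have "cis (B s) * cis (\<omega> s) = cis (\<omega> s + B s)" by (simp add: cis_mult add.commute)
    finally show ?thesis .
  qed
  show thesis
  proof (rule that)
    show "continuous_on {0..\<delta>} (\<lambda>s. \<omega> s + B s)" "continuous_on {0..\<delta>} (\<lambda>s. \<omega> s - A s - s)"
      by (intro continuous_intros cont_\<omega> cont_A cont_B)+
    fix s assume s: "s \<in> {0..\<delta>}"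
    have "s \<le> 1" "0 \<le> s" using s by (auto simp: \<delta>_def)
    then have "- (2 * pi) \<le> \<omega> s - A s - s" using angles[OF s] pi_gt3 by linarith
    then show "0 \<le> \<omega> s + B s \<and> s + (\<omega> s - A s - s) \<le> \<omega> s + B s \<and> \<bar>\<omega> s - A s - s\<bar> \<le> 2 * pi"
      using angles[OF s] \<open>0 \<le> s\<close> by linarith
    show "c0 * cis s + (c1 - c0) = c2 * cis (s + (\<omega> s - A s - s)) + (c1 - c2) * cis (\<omega> s + B s)"
      using eq[OF s] by (simp add: w_def)
  qed (use \<open>\<delta> > 0\<close> zero in auto)
qed

section \<open>Zeros at a peak\<close>

context interlaced_steps begin

text \<open>
  Write \<open>\<beta>\<close> for the middle gap. A frequency \<open>\<xi>\<close> realises the phases \<open>\<psi>\<close> (over distance \<open>1\<close>)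
  and \<open>\<theta>\<close> (over the gap \<open>\<beta>\<close>) if and only if \<open>(\<theta> - \<beta> * \<psi>) / (2 * pi)\<close> has the form
  \<open>m * \<beta> - j\<close> with integers \<open>m, j\<close>. Along the phase curve this quantity starts at \<open>0\<close>, becomes
  positive and is continuous, while the numbers \<open>m * \<beta> - j\<close> are dense even when \<open>m\<close> is required to
  be large; so the curve passes through one of them. Large \<open>m\<close> means high frequency, and at high
  frequency the remaining phase \<open>s\<close> is attained by moving the window inside step \<open>k\<close>.
\<close>

lemma STFT_step_zero_at_peak:
  assumes peak: "c k \<le> c (k + 1)" "c (k + 2) < c (k + 1)"
  shows "\<exists>x \<xi>. STFT (indicator {0<..<1}) step x \<xi> = 0"
proof -
  define \<gamma> where "\<gamma> = a (k + 1) - a k"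
  define \<beta> where "\<beta> = a (k + 2) - a (k + 1)"
  have \<beta>: "\<beta> \<notin> \<rat>" "0 < \<beta>" "\<beta> < 1" and \<gamma>: "\<gamma> > 0"
    using gap_irrational[of "k + 1"] a_less[of k] a_less[of "k + 1"] a_period[of k]
    by (auto simp: \<beta>_def \<gamma>_def add.assoc)
  obtain \<delta> \<theta> \<psi> where \<delta>: "\<delta> > 0" and cont: "continuous_on {0..\<delta>} \<theta>" "continuous_on {0..\<delta>} \<psi>"
    and zero: "\<theta> 0 = 0" "\<psi> 0 = 0"
    and bounds: "\<And>s. s \<in> {0..\<delta>} \<Longrightarrow> 0 \<le> \<theta> s \<and> s + \<psi> s \<le> \<theta> s \<and> \<bar>\<psi> s\<bar> \<le> 2 * pi"
    and eq: "\<And>s. s \<in> {0..\<delta>} \<Longrightarrow>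
      c k * cis s + (c (k + 1) - c k) = c (k + 2) * cis (s + \<psi> s) + (c (k + 1) - c (k + 2)) * cis (\<theta> s)"
    using peak_phase_curve[of "c k" "c (k + 1)" "c (k + 2)"] peak c_pos by blast
  define h where "h s = (\<theta> s - \<beta> * \<psi> s) / (2 * pi)" for s
  have h_pos: "h \<delta> > 0"
  proof -
    have "\<beta> * (\<delta> + \<psi> \<delta>) \<le> \<beta> * \<theta> \<delta>" "\<beta> * \<theta> \<delta> \<le> \<theta> \<delta>" "\<beta> * \<delta> > 0"
      using bounds[of \<delta>] \<beta> \<delta> by (auto intro: mult_left_mono mult_left_le_one_le)
    then show ?thesis unfolding h_def by (intro divide_pos_pos) (auto simp: algebra_simps)
  qed
  \<comment> \<open>The shift by \<open>M\<close> in the target of the approximation makes the multiplier of \<open>\<beta>\<close> exceed \<open>M\<close>.\<close>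
  define M :: int where "M = \<lceil>1 / \<gamma>\<rceil> + 1"
  obtain j m' where m': "m' > 0" "\<bar>of_int m' * \<beta> - of_int j - (h \<delta> / 2 - of_int M * \<beta>)\<bar> < h \<delta> / 2"
    using sequence_of_fractional_parts_is_dense[OF \<beta>(1) half_gt_zero[OF h_pos]] by blast
  define m where "m = m' + M"
  have m: "0 \<le> of_int m * \<beta> - of_int j" "of_int m * \<beta> - of_int j \<le> h \<delta>"
    using m'(2) unfolding m_def of_int_add distrib_right by linarith+
  have "continuous_on {0..\<delta>} h"
    unfolding h_def by (intro continuous_intros cont) auto
  then obtain s where s: "s \<in> {0..\<delta>}" "h s = of_int m * \<beta> - of_int j"
    using IVT'[of h 0 "of_int m * \<beta> - of_int j" \<delta>] m \<delta> zero by (auto simp: h_def)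
  \<comment> \<open>The sign is that of the exponent of \<^const>\<open>wave\<close>; rounding \<open>s / (2 * pi)\<close> up puts \<open>x\<close> to the left of the breakpoint.\<close>
  define \<xi> where "\<xi> = - (\<psi> s / (2 * pi) + of_int m)"
  define x where "x = a (k + 1) - (of_int \<lceil>s / (2 * pi)\<rceil> - s / (2 * pi)) / (- \<xi>)"
  \<comment> \<open>One period of the character fits into step \<open>k\<close>, whose length is \<open>\<gamma>\<close>.\<close>
  have \<xi>: "- \<xi> \<ge> 1 / \<gamma>"
  proof -
    have "- 1 \<le> \<psi> s / (2 * pi)" using bounds[OF s(1)] by (simp add: le_divide_eq abs_le_iff)
    moreover have "1 / \<gamma> \<le> of_int M - 1" by (simp add: M_def)
    moreover have "of_int M \<le> real_of_int m" using m'(1) by (simp add: m_def)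
    ultimately show ?thesis by (simp add: \<xi>_def)
  qed
  have \<xi>_neg: "\<xi> < 0" using \<xi> \<gamma> by (smt (verit) divide_pos_pos)
  have x: "a k \<le> x" "x \<le> a (k + 1)"
  proof -
    define y where "y = of_int \<lceil>s / (2 * pi)\<rceil> - s / (2 * pi)"
    have y: "0 \<le> y" "y \<le> 1" unfolding y_def by linarith+
    have "1 \<le> - \<xi> * \<gamma>" using \<xi> \<gamma> by (simp add: divide_le_eq)
    then have "y \<le> \<gamma> * (- \<xi>)" using y by (simp add: mult.commute)
    then have "y / (- \<xi>) \<le> \<gamma>" using \<xi>_neg by (subst pos_divide_le_eq) auto
    moreover have "0 \<le> y / (- \<xi>)" using y \<xi>_neg by (intro divide_nonneg_pos) auto
    ultimately show "a k \<le> x" "x \<le> a (k + 1)" by (auto simp: x_def y_def \<gamma>_def)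
  qed
  have cis_shift: "cis (t + 2 * pi * of_int n) = cis t" for t n
    by (simp flip: cis_mult)
  have wave_x: "wave \<xi> x = wave \<xi> (a (k + 1)) * cis s"
  proof -
    have "- 2 * pi * \<xi> * x = - 2 * pi * \<xi> * a (k + 1) + s + 2 * pi * of_int (- \<lceil>s / (2 * pi)\<rceil>)"
      unfolding x_def using \<xi>_neg by (simp add: field_simps)
    then show ?thesis unfolding wave_def by (simp only: cis_shift cis_mult)
  qed
  have wave_1: "wave \<xi> 1 = cis (\<psi> s)"
  proof -
    have "- 2 * pi * \<xi> * 1 = \<psi> s + 2 * pi * of_int m" by (simp add: \<xi>_def field_simps)
    then show ?thesis unfolding wave_def by (simp only: cis_shift)
  qed
  have wave_b: "wave \<xi> (a (k + 2)) = wave \<xi> (a (k + 1)) * cis (\<theta> s)"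
  proof -
    have "\<theta> s = 2 * pi * (of_int m * \<beta> - of_int j) + \<beta> * \<psi> s"
      using s(2) by (simp add: h_def field_simps)
    then have "- 2 * pi * \<xi> * \<beta> = \<theta> s + 2 * pi * of_int j"
      by (simp add: \<xi>_def field_simps)
    then have "wave \<xi> \<beta> = cis (\<theta> s)" unfolding wave_def by (simp only: cis_shift)
    then show ?thesis using wave_add[of \<xi> "a (k + 1)" \<beta>] by (simp add: \<beta>_def)
  qed
  have "c k * wave \<xi> x + (c (k + 1) - c k) * wave \<xi> (a (k + 1)) + (c (k + 2) - c (k + 1)) * wave \<xi> (a (k + 2))
     = wave \<xi> (a (k + 1)) * (c k * cis s + (c (k + 1) - c k) - (c (k + 1) - c (k + 2)) * cis (\<theta> s))"
    unfolding wave_x wave_b by (simp add: algebra_simps)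
  also have "\<dots> = wave \<xi> (a (k + 1)) * (c (k + 2) * cis (s + \<psi> s))"
    using eq[OF s(1)] by simp
  also have "\<dots> = c (k + 2) * wave \<xi> (x + 1)"
    unfolding wave_add wave_x wave_1 by (simp add: cis_mult[symmetric])
  finally have "STFT (indicator {0<..<1}) step x \<xi> = 0"
    using STFT_step_zero_iff[OF x] \<xi>_neg by simp
  then show ?thesis by blast
qed

end

theorem theorem7p3:
  fixes c a :: "int \<Rightarrow> real" and \<alpha> :: real and g \<phi> :: "real \<Rightarrow> complex"
  assumes c_bounded: "bounded (range c)"
    and c_pos: "\<And>k. c k > 0"
    and \<alpha>: "\<alpha> \<in> {0<..<1} - \<rat>"
    and a_even: "\<And>k. a (2 * k) = of_int k"
    and a_odd: "\<And>k. a (2 * k + 1) = of_int k + \<alpha>"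
    and window: "g = indicator {0<..<1}"
    and \<phi>: "\<phi> = step_fun a c"
  shows "(strict_mono c \<or> strict_antimono_on UNIV c \<longrightarrow>
            in_Linfty \<phi> \<and> (\<forall>x \<xi>. STFT g \<phi> x \<xi> \<noteq> 0))
       \<and> ((\<exists>p\<ge>1. in_Lp p \<phi>) \<longrightarrow> (\<exists>x \<xi>. STFT g \<phi> x \<xi> = 0))"
proof -
  have gap: "a (k + 1) - a k \<in> {\<alpha>, 1 - \<alpha>}" and period: "a (k + 2) = a k + 1" for k
  proof -
    obtain n where "k = 2 * n \<or> k = 2 * n + 1" using oddE evenE by metis
    then show "a (k + 1) - a k \<in> {\<alpha>, 1 - \<alpha>}" "a (k + 2) = a k + 1"
      using a_even[of n] a_odd[of n] a_even[of "n + 1"] a_odd[of "n + 1"]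
      by (auto simp: algebra_simps)
  qed
  have "1 - \<alpha> \<notin> \<rat>"
    using \<alpha> Rats_diff[of 1 "1 - \<alpha>"] by auto
  interpret interlaced_steps a c
  proof
    fix k
    show "a k < a (k + 1)" using gap[of k] \<alpha> by auto
    show "a (k + 1) - a k \<notin> \<rat>" using gap[of k] \<alpha> \<open>1 - \<alpha> \<notin> \<rat>\<close> by auto
  qed (use period c_pos in auto)
  show ?thesis
    unfolding window \<phi>
    using STFT_step_nonzero in_Linfty_step[OF c_bounded] peak_if_in_Lp STFT_step_zero_at_peak by blast
qed

end
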